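(* Let $F:\mathbb{T}\to\mathbb{T}$ be Lipschitz, $h\in C^1(\mathbb{T}\times\mathbb{T})$ and $\Delta>0$. Then there exists a constant $C>0$, depending only on $\Delta$, $\mathrm{Lip}(F)$ and $\|h\|_{C^1}$, such that for every $N\geq 1$, every solution $(x_1(t),\dots,x_N(t))_{t\ge 0}$ of the particle system $$x_i(t+1)=F\Big(x_i(t)+\frac{\Delta}{N}\sum_{j=1}^N h(x_i(t),x_j(t))\Big),\quad i=1,\dots,N,$$ with empirical measures $\mu_N(t)=\frac1N\sum_{j=1}^N\delta_{x_j(t)}$, and every sequence of probability measures $\bar\rho_t\in\mathcal{P}(\mathbb{T})$, $t=0,1,\dots$, solving $\bar\rho_{t+1}=(F_{\bar\rho_t})_*\bar\rho_t$, one has $$W_1(\mu_N(t),\bar\rho_t)\leq e^{Ct}\,W_1(\mu_N(0),\bar\rho_0),\qquad t=0,1,\dots$$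
   Context: $\mathbb{T}=\mathbb{R}/\mathbb{Z}$ is the one-dimensional torus with its usual distance; $\mathcal{P}(\mathbb{T})$ is the set of Borel probability measures on $\mathbb{T}$; $h$ is real-valued and sums $x+(\text{real number})$ with $x\in\mathbb{T}$ are taken modulo $1$. For $\mu\in\mathcal{P}(\mathbb{T})$, $\phi_\mu(x):=x+\Delta\int_{\mathbb{T}}h(x,y)\,d\mu(y)$ and $F_\mu:=F\circ\phi_\mu$. $G_*\mu$ denotes the push-forward of $\mu$ under $G$. $W_1$ is the $1$-Wasserstein distance on $\mathcal{P}(\mathbb{T})$, $W_1(\mu,\nu)=\inf_\pi\int d(x,y)\,d\pi(x,y)$ over couplings $\pi$ of $\mu,\nu$. *)

theory Defs
  imports "HOL-Probability.Probability"
begin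

quotient_type torus = real / "\<lambda>x y :: real. x - y \<in> \<int>"
  morphisms rep_torus proj_torus
proof (rule equivpI)
  show "reflp (\<lambda>x y :: real. x - y \<in> \<int>)"
    by (auto simp: reflp_def)
  show "symp (\<lambda>x y :: real. x - y \<in> \<int>)"
    by (auto simp: symp_def) (metis Ints_minus minus_diff_eq)
  show "transp (\<lambda>x y :: real. x - y \<in> \<int>)"
    by (auto simp: transp_def) (metis Ints_add diff_add_cancel add_diff_eq)
qed

lemma closed_real_Ints: "closed (\<int> :: real set)"
  by (rule closed_subset_Ints) simp

lemma infdist_Ints_minus: "infdist (- x) \<int> = infdist (x :: real) \<int>"
proof -
  have le: "infdist (- x) \<int> \<le> infdist x \<int>" for x :: real
  proof -
    obtain n where n: "n \<in> \<int>" "infdist x \<int> = dist x n"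
      using infdist_attains_inf[OF closed_real_Ints, of x] Ints_0 by blast
    have "infdist (- x) \<int> \<le> dist (- x) (- n)"
      using n by (intro infdist_le) simp
    also have "\<dots> = infdist x \<int>"
      using n by (simp add: dist_real_def)
    finally show ?thesis .
  qed
  from le[of x] le[of "- x"] show ?thesis by simp
qed

lemma infdist_Ints_add: "infdist (x + y) \<int> \<le> infdist x \<int> + infdist (y :: real) \<int>"
proof -
  obtain m where m: "m \<in> \<int>" "infdist x \<int> = dist x m"
    using infdist_attains_inf[OF closed_real_Ints, of x] Ints_0 by blast
  obtain n where n: "n \<in> \<int>" "infdist y \<int> = dist y n"
    using infdist_attains_inf[OF closed_real_Ints, of y] Ints_0 by blast
  have "infdist (x + y) \<int> \<le> dist (x + y) (m + n)"
    using m n by (intro infdist_le) simp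
  also have "\<dots> \<le> dist x m + dist y n"
    by (simp add: dist_real_def)
  finally show ?thesis using m n by simp
qed

lemma infdist_Ints_eq_0_iff: "infdist x \<int> = 0 \<longleftrightarrow> (x :: real) \<in> \<int>"
  using in_closed_iff_infdist_zero[OF closed_real_Ints, of x] Ints_0 by blast

lemma infdist_Ints_cong:
  assumes "(x :: real) - y \<in> \<int>"
  shows "infdist x \<int> = infdist y \<int>"
proof -
  have "infdist (x - y) \<int> = 0" "infdist (y - x) \<int> = 0"
    using assms infdist_Ints_eq_0_iff infdist_Ints_minus[of "x - y"] by auto
  with infdist_Ints_add[of "x - y" y] infdist_Ints_add[of "y - x" x]
  show ?thesis by simp
qed

text \<open>The usual distance on \<open>\<real>/\<int>\<close>: the minimum of \<open>\<bar>x - y - n\<bar>\<close> over the integers \<open>n\<close>.\<close>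

instantiation torus :: metric_space
begin

lift_definition dist_torus :: "torus \<Rightarrow> torus \<Rightarrow> real"
  is "\<lambda>x y. infdist (x - y) \<int>"
proof (rule infdist_Ints_cong)
  fix a b c d :: real
  assume "a - b \<in> \<int>" "c - d \<in> \<int>"
  then have "(a - b) - (c - d) \<in> \<int>" by (rule Ints_diff)
  then show "(a - c) - (b - d) \<in> \<int>" by (simp add: algebra_simps)
qed

definition uniformity_torus :: "(torus \<times> torus) filter" where
  "uniformity_torus = (INF e\<in>{0 <..}. principal {(x, y). dist x y < e})"

definition open_torus :: "torus set \<Rightarrow> bool" where
  "open_torus U \<longleftrightarrow> (\<forall>x\<in>U. \<forall>\<^sub>F (x', y) in uniformity. x' = x \<longrightarrow> y \<in> U)"

instance
proof
  show "dist x y = 0 \<longleftrightarrow> x = y" for x y :: torus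
    by transfer (rule infdist_Ints_eq_0_iff)
  show "dist x y \<le> dist x z + dist y z" for x y z :: torus
  proof transfer
    fix x y z :: real
    show "infdist (x - y) \<int> \<le> infdist (x - z) \<int> + infdist (y - z) \<int>"
      using infdist_Ints_add[of "x - z" "z - y"] infdist_Ints_minus[of "y - z"] by simp
  qed
qed (rule uniformity_torus_def open_torus_def)+

end

lift_definition shift :: "torus \<Rightarrow> real \<Rightarrow> torus" (infixl "\<oplus>" 65)
  is "\<lambda>x s. x + s"
  by simp

definition Lip :: "('a::metric_space \<Rightarrow> 'b::metric_space) \<Rightarrow> real" where
  "Lip F = Inf {L. L-lipschitz_on UNIV F}"

definition partial1 :: "(torus \<Rightarrow> torus \<Rightarrow> real) \<Rightarrow> torus \<Rightarrow> torus \<Rightarrow> real" where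
  "partial1 h x y = deriv (\<lambda>s :: real. h (x \<oplus> s) y) 0"

definition partial2 :: "(torus \<Rightarrow> torus \<Rightarrow> real) \<Rightarrow> torus \<Rightarrow> torus \<Rightarrow> real" where
  "partial2 h x y = deriv (\<lambda>s :: real. h x (y \<oplus> s)) 0"

definition C1_torus2 :: "(torus \<Rightarrow> torus \<Rightarrow> real) \<Rightarrow> bool" where
  "C1_torus2 h \<longleftrightarrow>
     continuous_on UNIV (\<lambda>(x, y). h x y) \<and>
     (\<forall>x y. (\<lambda>s :: real. h (x \<oplus> s) y) field_differentiable at 0) \<and>
     (\<forall>x y. (\<lambda>s :: real. h x (y \<oplus> s)) field_differentiable at 0) \<and>
     continuous_on UNIV (\<lambda>(x, y). partial1 h x y) \<and>
     continuous_on UNIV (\<lambda>(x, y). partial2 h x y)"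

text \<open>
  Sum convention for the \<open>C\<^sup>1\<close> norm. The suprema are finite for \<open>h\<close> of class \<open>C\<^sup>1\<close>
  because the torus is compact.
\<close>

definition C1_norm :: "(torus \<Rightarrow> torus \<Rightarrow> real) \<Rightarrow> real" where
  "C1_norm h =
     (SUP (x, y). \<bar>h x y\<bar>) + (SUP (x, y). \<bar>partial1 h x y\<bar>) + (SUP (x, y). \<bar>partial2 h x y\<bar>)"

definition prob_measures :: "'a::topological_space measure set" where
  "prob_measures = {\<mu>. sets \<mu> = sets borel \<and> prob_space \<mu>}"

definition couplings ::
  "'a::metric_space measure \<Rightarrow> 'a measure \<Rightarrow> ('a \<times> 'a) measure set" where
  "couplings \<mu> \<nu> =
     {\<pi> \<in> prob_measures. distr \<pi> borel fst = \<mu> \<and> distr \<pi> borel snd = \<nu>}"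

text \<open>On the compact torus every coupling has finite cost, so a real-valued infimum suffices.\<close>

definition W1 :: "torus measure \<Rightarrow> torus measure \<Rightarrow> real" where
  "W1 \<mu> \<nu> = (INF \<pi>\<in>couplings \<mu> \<nu>. \<integral>p. dist (fst p) (snd p) \<partial>\<pi>)"

definition empirical :: "nat \<Rightarrow> (nat \<Rightarrow> 'a::topological_space) \<Rightarrow> 'a measure" where
  "empirical N x =
     measure_of UNIV (sets borel) (\<lambda>A. (\<Sum>j=1..N. emeasure (return borel (x j)) A) / of_nat N)"

lemma emeasure_empirical:
  fixes x :: "nat \<Rightarrow> 'a::topological_space"
  assumes "A \<in> sets borel"
  shows "emeasure (empirical N x) A = (\<Sum>j=1..N. emeasure (return borel (x j)) A) / of_nat N"
proof (rule emeasure_measure_of[OF empirical_def])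
  show "countably_additive (sets (empirical N x))
          (\<lambda>A. (\<Sum>j=1..N. emeasure (return borel (x j)) A) / of_nat N)"
  proof (rule countably_additiveI)
    fix A :: "nat \<Rightarrow> 'a set"
    assume "range A \<subseteq> sets (empirical N x)" "disjoint_family A"
    then have "(\<Sum>i. emeasure (return borel (x j)) (A i)) = emeasure (return borel (x j)) (\<Union>i. A i)" for j
      by (intro suminf_emeasure) (auto simp: empirical_def sets.sigma_sets_eq[of borel, simplified])
    then show "(\<Sum>i. (\<Sum>j=1..N. emeasure (return borel (x j)) (A i)) / of_nat N) =
        (\<Sum>j=1..N. emeasure (return borel (x j)) (\<Union>i. A i)) / of_nat N"
      by (simp add: divide_ennreal_def ennreal_suminf_multc suminf_sum[OF summableI])
  qed
qed (use assms in \<open>auto simp: empirical_def positive_def sets.sigma_sets_eq[of borel, simplified]\<close>)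

definition mf_shift :: "(torus \<Rightarrow> torus \<Rightarrow> real) \<Rightarrow> real \<Rightarrow> torus measure \<Rightarrow> torus \<Rightarrow> torus" where
  "mf_shift h \<Delta> \<mu> x = x \<oplus> \<Delta> * (\<integral>y. h x y \<partial>\<mu>)"

definition mf_map ::
  "(torus \<Rightarrow> torus) \<Rightarrow> (torus \<Rightarrow> torus \<Rightarrow> real) \<Rightarrow> real \<Rightarrow> torus measure \<Rightarrow> torus \<Rightarrow> torus" where
  "mf_map F h \<Delta> \<mu> = F \<circ> mf_shift h \<Delta> \<mu>"

definition particle_solution ::
  "(torus \<Rightarrow> torus) \<Rightarrow> (torus \<Rightarrow> torus \<Rightarrow> real) \<Rightarrow> real \<Rightarrow> nat \<Rightarrow> (nat \<Rightarrow> nat \<Rightarrow> torus) \<Rightarrow> bool" where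
  "particle_solution F h \<Delta> N x \<longleftrightarrow>
     (\<forall>t. \<forall>i\<in>{1..N}. x (t + 1) i = F (x t i \<oplus> \<Delta> / real N * (\<Sum>j=1..N. h (x t i) (x t j))))"

definition mf_solution ::
  "(torus \<Rightarrow> torus) \<Rightarrow> (torus \<Rightarrow> torus \<Rightarrow> real) \<Rightarrow> real \<Rightarrow> (nat \<Rightarrow> torus measure) \<Rightarrow> bool" where
  "mf_solution F h \<Delta> \<rho> \<longleftrightarrow>
     (\<forall>t. \<rho> t \<in> prob_measures) \<and> (\<forall>t. \<rho> (t + 1) = distr (\<rho> t) borel (mf_map F h \<Delta> (\<rho> t)))"

end

theory Submission
  imports Defs
begin

text \<open>
  If \<open>\<pi>\<close> is a coupling of \<open>\<mu>\<close> and \<open>\<nu>\<close>, then its push-forward under \<open>F\<^sub>\<mu> \<times> F\<^sub>\<nu>\<close> is a coupling of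
  the images. Both mean-field integrals can be written as integrals against \<open>\<pi>\<close>, so the cost grows
  by at most the factor \<open>Lip F * (1 + 2 \<Delta> \<parallel>h\<parallel>)\<close>; no duality and no optimal coupling are needed. The
  empirical measures themselves solve the mean-field equation, hence the bound iterates in time.
\<close>

section \<open>Shifts, distance and compactness of the torus\<close>

lemma proj_torus_rep_torus [simp]: "proj_torus (rep_torus x) = x"
  using Quotient3_torus by (rule Quotient3_abs_rep)

lemma shift_0 [simp]: "x \<oplus> 0 = x"
  by transfer simp

lemma shift_shift: "x \<oplus> s \<oplus> u = x \<oplus> (s + u)"
  by transfer (simp add: algebra_simps)

lemma dist_proj_torus_le: "dist (proj_torus x) (proj_torus y) \<le> \<bar>x - y\<bar>"
  using infdist_le[of 0 \<int> "x - y"] by (simp add: dist_torus.abs_eq dist_real_def)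

lemma dist_shift_le: "dist (x \<oplus> a) (y \<oplus> b) \<le> dist x y + \<bar>a - b\<bar>"
proof transfer
  fix x a y b :: real
  have "infdist (a - b) \<int> \<le> \<bar>a - b\<bar>"
    using infdist_le[of 0 \<int> "a - b"] by (simp add: dist_real_def)
  then show "infdist (x + a - (y + b)) \<int> \<le> infdist (x - y) \<int> + \<bar>a - b\<bar>"
    using infdist_Ints_add[of "x - y" "a - b"] by (simp add: algebra_simps)
qed

text \<open>A shortest arc exists because the closed set of integers has a point nearest to any
  real. Moving along it reduces estimates on the torus to real analysis.\<close>

lemma torus_eq_shift_dist:
  obtains s where "y = x \<oplus> s" "\<bar>s\<bar> = dist x y"
proof -
  have "\<exists>s. y = x \<oplus> s \<and> \<bar>s\<bar> = dist x y"
  proof transfer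
    fix y x :: real
    obtain n where n: "n \<in> \<int>" "infdist (x - y) \<int> = dist (x - y) n"
      using infdist_attains_inf[OF closed_real_Ints, of "x - y"] Ints_0 by blast
    then show "\<exists>s. y - (x + s) \<in> \<int> \<and> \<bar>s\<bar> = infdist (x - y) \<int>"
      by (intro exI[of _ "y - x + n"]) (auto simp: dist_real_def)
  qed
  then show ?thesis using that by blast
qed

text \<open>Fractional parts are representatives in the unit interval, so the torus is a continuous
  image of a compact set.\<close>

lemma compact_UNIV_torus: "compact (UNIV :: torus set)"
proof -
  have "1-lipschitz_on {0..1} proj_torus"
    by (intro lipschitz_onI) (simp_all add: dist_proj_torus_le dist_real_def)
  then have "compact (proj_torus ` {0..1})"
    by (intro compact_continuous_image lipschitz_on_continuous_on) auto
  moreover have "proj_torus ` {0..1} = UNIV"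
  proof (intro equalityI subsetI)
    fix x :: torus
    have "x = proj_torus (frac (rep_torus x))"
      by (subst proj_torus_rep_torus[of x, symmetric], subst torus.abs_eq_iff) (simp add: frac_def)
    moreover have "frac (rep_torus x) \<in> {0..1}"
      using frac_lt_1[of "rep_torus x"] by simp
    ultimately show "x \<in> proj_torus ` {0..1}" by blast
  qed simp
  ultimately show ?thesis by simp
qed

lemma compact_UNIV_torus2: "compact (UNIV :: (torus \<times> torus) set)"
  using compact_Times[OF compact_UNIV_torus compact_UNIV_torus] by simp

section \<open>Lipschitz bounds for \<open>h\<close> and \<open>F\<close>\<close>

lemma bdd_above_abs_compact:
  fixes f :: "'a::topological_space \<Rightarrow> real"
  assumes "compact (UNIV :: 'a set)" "continuous_on UNIV f"
  shows "bdd_above (range (\<lambda>x. \<bar>f x\<bar>))"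
  using assms
  by (intro bounded_imp_bdd_above compact_imp_bounded compact_continuous_image continuous_intros)

text \<open>Mean value inequality along a shortest arc from \<open>x\<close> to
  \<open>y\<close>.\<close>

lemma lipschitz_of_deriv_bound:
  fixes f :: "torus \<Rightarrow> real"
  assumes "\<And>x. (\<lambda>s :: real. f (x \<oplus> s)) field_differentiable at 0"
    and "\<And>x. \<bar>deriv (\<lambda>s :: real. f (x \<oplus> s)) 0\<bar> \<le> K"
  shows "\<bar>f x - f y\<bar> \<le> K * dist x y"
proof -
  obtain s where s: "y = x \<oplus> s" "\<bar>s\<bar> = dist x y"
    by (rule torus_eq_shift_dist)
  \<comment> \<open>Derivatives are given only at 0. The slope at \<open>u\<close> is the slope at 0
    for the base point \<open>x \<oplus> u\<close>, so the hypothesis bounds the derivative along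
    the whole arc.\<close>
  have der: "((\<lambda>s. f (x \<oplus> s)) has_field_derivative deriv (\<lambda>s. f (x \<oplus> u \<oplus> s)) 0) (at u)" for u
    using assms(1)[of "x \<oplus> u"] DERIV_shift[of "\<lambda>s. f (x \<oplus> s)" _ 0 u]
    by (simp add: field_differentiable_derivI shift_shift add.commute
        flip: DERIV_deriv_iff_field_differentiable)
  have "norm (f (x \<oplus> 0) - f (x \<oplus> s)) \<le> K * norm (0 - s)"
    by (rule field_differentiable_bound[OF convex_UNIV]) (use der assms(2) in auto)
  then show ?thesis using s by simp
qed

text \<open>One variable is changed at a time, at the price of the supremum of one partial
  derivative. \<open>C1_norm h\<close> dominates both suprema because its three terms are
  nonnegative.\<close>

lemma C1_torus2_lipschitz:
  assumes "C1_torus2 h"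
  shows "\<bar>h x y - h x' y'\<bar> \<le> C1_norm h * (dist x x' + dist y y')" "C1_norm h \<ge> 0"
proof -
  let ?a = "SUP (x, y). \<bar>h x y\<bar>"
  let ?b = "SUP (x, y). \<bar>partial1 h x y\<bar>"
  let ?c = "SUP (x, y). \<bar>partial2 h x y\<bar>"
  have bound: "\<bar>g x y\<bar> \<le> (SUP (x, y). \<bar>g x y\<bar>)"
    if "continuous_on UNIV (\<lambda>(x, y). g x y)" for g :: "torus \<Rightarrow> torus \<Rightarrow> real" and x y
    using cSUP_upper[OF UNIV_I bdd_above_abs_compact[OF compact_UNIV_torus2 that], of "(x, y)"]
    by (simp add: case_prod_unfold)
  have a: "\<bar>h x y\<bar> \<le> ?a" and b: "\<bar>partial1 h x y\<bar> \<le> ?b" and c: "\<bar>partial2 h x y\<bar> \<le> ?c" for x y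
    using assms unfolding C1_torus2_def by (blast intro: bound)+
  have nonneg: "?a \<ge> 0" "?b \<ge> 0" "?c \<ge> 0"
    using a[of x y] b[of x y] c[of x y] by linarith+
  then show "C1_norm h \<ge> 0" by (simp add: C1_norm_def)
  have "\<bar>h x y - h x' y\<bar> \<le> ?b * dist x x'"
    using assms b unfolding C1_torus2_def partial1_def
    by (intro lipschitz_of_deriv_bound) auto
  moreover have "\<bar>h x' y - h x' y'\<bar> \<le> ?c * dist y y'"
    using assms c unfolding C1_torus2_def partial2_def
    by (intro lipschitz_of_deriv_bound) auto
  moreover have "?b * dist x x' \<le> C1_norm h * dist x x'" "?c * dist y y' \<le> C1_norm h * dist y y'"
    using nonneg by (auto simp: C1_norm_def intro!: mult_right_mono)
  ultimately show "\<bar>h x y - h x' y'\<bar> \<le> C1_norm h * (dist x x' + dist y y')"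
    by (simp add: distrib_left)
qed

text \<open>The infimum in \<open>Lip\<close> is attained: for \<open>x \<noteq> y\<close> the
  difference quotient is a lower bound of all Lipschitz constants. The given \<open>L\<close> keeps
  that set nonempty, so that the real \<open>Inf\<close> is meaningful.\<close>

lemma lipschitz_on_Lip:
  assumes "L-lipschitz_on UNIV F"
  shows "(Lip F)-lipschitz_on UNIV F"
proof (rule lipschitz_onI)
  have ne: "{L. L-lipschitz_on UNIV F} \<noteq> {}" using assms by blast
  show "0 \<le> Lip F"
    unfolding Lip_def using ne by (intro cInf_greatest) (auto dest: lipschitz_on_nonneg)
  fix x y
  show "dist (F x) (F y) \<le> Lip F * dist x y"
  proof (cases "x = y")
    case False
    have "dist (F x) (F y) / dist x y \<le> Lip F"
      unfolding Lip_def using ne False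
      by (intro cInf_greatest) (auto simp: pos_divide_le_eq dest: lipschitz_onD)
    then show ?thesis using False by (simp add: pos_divide_le_eq)
  qed simp
qed

section \<open>Borel probability measures, couplings and transport cost\<close>

lemma prob_measures_sets: "\<mu> \<in> prob_measures \<Longrightarrow> sets \<mu> = sets borel"
  by (simp add: prob_measures_def)

lemma prob_measures_prob_space: "\<mu> \<in> prob_measures \<Longrightarrow> prob_space \<mu>"
  by (simp add: prob_measures_def)

lemma measurable_prob_measures:
  assumes "\<mu> \<in> prob_measures"
  shows "measurable \<mu> N = measurable borel N"
  using prob_measures_sets[OF assms] by (intro measurable_cong_sets) auto

lemma distr_prob_measures:
  assumes "\<mu> \<in> prob_measures" "G \<in> borel_measurable borel"
  shows "distr \<mu> borel G \<in> prob_measures"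
  using assms prob_space.prob_space_distr[of \<mu> G borel]
  by (auto simp: prob_measures_def measurable_prob_measures)

lemma integrable_continuous_compact:
  fixes f :: "'a::topological_space \<Rightarrow> real"
  assumes "compact (UNIV :: 'a set)" "\<mu> \<in> prob_measures" "continuous_on UNIV f"
  shows "integrable \<mu> f"
proof -
  interpret prob_space \<mu> using assms(2) by (rule prob_measures_prob_space)
  have "\<bar>f x\<bar> \<le> (SUP x. \<bar>f x\<bar>)" for x
    using bdd_above_abs_compact[OF assms(1,3)] by (intro cSUP_upper) auto
  then show ?thesis
    using assms
    by (intro integrable_const_bound[where B = "SUP x. \<bar>f x\<bar>"])
       (auto simp: measurable_prob_measures intro: borel_measurable_continuous_onI)
qed

lemma couplingsD:
  assumes "\<pi> \<in> couplings \<mu> \<nu>"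
  shows "\<pi> \<in> prob_measures" "distr \<pi> borel fst = \<mu>" "distr \<pi> borel snd = \<nu>"
  using assms by (auto simp: couplings_def)

text \<open>Costs are nonnegative, so the family is bounded below and the real infimum is a genuine
  lower bound.\<close>

lemma W1_le:
  assumes "\<pi> \<in> couplings \<mu> \<nu>"
  shows "W1 \<mu> \<nu> \<le> (\<integral>p. dist (fst p) (snd p) \<partial>\<pi>)"
  unfolding W1_def using assms
  by (intro cINF_lower bdd_belowI2[where m = 0] integral_nonneg_AE) auto

text \<open>Passes a bound valid for every coupling to the infimum, without a minimizing coupling.
  The proof divides by \<open>c\<close>; for \<open>c = 0\<close> any single coupling already gives
  \<open>w \<le> 0\<close>.\<close>

lemma mult_W1_greatest:
  assumes "couplings \<mu> \<nu> \<noteq> {}" "0 \<le> c"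
    and "\<And>\<pi>. \<pi> \<in> couplings \<mu> \<nu> \<Longrightarrow> w \<le> c * (\<integral>p. dist (fst p) (snd p) \<partial>\<pi>)"
  shows "w \<le> c * W1 \<mu> \<nu>"
proof (cases "c = 0")
  case True
  then show ?thesis using assms by fastforce
next
  case False
  then have "w / c \<le> W1 \<mu> \<nu>"
    unfolding W1_def using assms
    by (intro cINF_greatest) (auto simp: pos_divide_le_eq mult.commute)
  then show ?thesis using False assms(2) by (simp add: pos_divide_le_eq mult.commute)
qed

text \<open>Projections commute with \<open>map_prod\<close>, so marginals are pushed forward
  separately. Continuity of \<open>G\<close> and \<open>H\<close> makes \<open>map_prod G H\<close>
  Borel for the product topology, on which couplings live.\<close>

lemma push_coupling:
  fixes \<mu> \<nu> :: "'a::metric_space measure" and G H :: "'a \<Rightarrow> 'a"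
  assumes \<pi>: "\<pi> \<in> couplings \<mu> \<nu>" and cont: "continuous_on UNIV G" "continuous_on UNIV H"
  shows "distr \<pi> borel (map_prod G H) \<in> couplings (distr \<mu> borel G) (distr \<nu> borel H)"
proof -
  note [measurable] = borel_measurable_continuous_onI[OF cont(1)]
    borel_measurable_continuous_onI[OF cont(2)]
  have "continuous_on UNIV (map_prod G H)"
    unfolding map_prod_def case_prod_unfold
    by (intro continuous_intros continuous_on_compose2[OF cont(1)] continuous_on_compose2[OF cont(2)]) auto
  note GH = borel_measurable_continuous_onI[OF this]
  have fst_snd: "(fst :: 'a \<times> 'a \<Rightarrow> 'a) \<in> borel_measurable borel"
    "(snd :: 'a \<times> 'a \<Rightarrow> 'a) \<in> borel_measurable borel"
    by (intro borel_measurable_continuous_onI continuous_intros)+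
  note meas = GH fst_snd measurable_prob_measures[OF couplingsD(1)[OF \<pi>]]
  have "distr (distr \<pi> borel (map_prod G H)) borel fst = distr (distr \<pi> borel fst) borel G"
    "distr (distr \<pi> borel (map_prod G H)) borel snd = distr (distr \<pi> borel snd) borel H"
    by (simp_all add: distr_distr meas fst_comp_map_prod snd_comp_map_prod comp_def)
  then show ?thesis
    using couplingsD[OF \<pi>] distr_prob_measures[OF _ GH] by (simp add: couplings_def)
qed

section \<open>One step of the mean-field dynamics\<close>

context
  fixes F :: "torus \<Rightarrow> torus" and h :: "torus \<Rightarrow> torus \<Rightarrow> real" and \<Delta> L K :: real
  assumes F: "L-lipschitz_on UNIV F" and \<Delta>: "\<Delta> \<ge> 0" and K: "K \<ge> 0"
    and h: "\<And>x y x' y'. \<bar>h x y - h x' y'\<bar> \<le> K * (dist x x' + dist y y')"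
begin

lemma continuous_h: "continuous_on UNIV (h x)"
proof -
  have "K-lipschitz_on UNIV (h x)"
    using h[of x _ x] K by (intro lipschitz_onI) (auto simp: dist_real_def)
  then show ?thesis by (rule lipschitz_on_continuous_on)
qed

text \<open>The marginals of \<open>\<pi>\<close> turn both integrals into integrals against
  \<open>\<pi>\<close>, where the Lipschitz bound of \<open>h\<close> applies pointwise.\<close>

lemma mean_field_integral_diff:
  assumes \<pi>: "\<pi> \<in> couplings \<mu> \<nu>"
  shows "\<bar>(\<integral>z. h x z \<partial>\<mu>) - (\<integral>z. h y z \<partial>\<nu>)\<bar>
    \<le> K * (dist x y + (\<integral>p. dist (fst p) (snd p) \<partial>\<pi>))"
proof -
  interpret prob_space \<pi> using couplingsD(1)[OF \<pi>] by (rule prob_measures_prob_space)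
  note int = integrable_continuous_compact[OF compact_UNIV_torus2 couplingsD(1)[OF \<pi>]]
  note hcont = continuous_on_compose2[OF continuous_h]
  have meas: "fst \<in> \<pi> \<rightarrow>\<^sub>M borel" "snd \<in> \<pi> \<rightarrow>\<^sub>M borel" "h x \<in> borel_measurable borel" for x
    unfolding measurable_prob_measures[OF couplingsD(1)[OF \<pi>]]
    by (intro borel_measurable_continuous_onI continuous_intros continuous_h)+
  have ints: "integrable \<pi> (\<lambda>p. h x (fst p))" "integrable \<pi> (\<lambda>p. h y (snd p))"
    "integrable \<pi> (\<lambda>p. dist (fst p) (snd p))"
    by (intro int hcont continuous_intros; simp)+
  have "(\<integral>z. h x z \<partial>\<mu>) = (\<integral>p. h x (fst p) \<partial>\<pi>)"
    by (subst couplingsD(2)[OF \<pi>, symmetric], rule integral_distr[OF meas(1,3)])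
  moreover have "(\<integral>z. h y z \<partial>\<nu>) = (\<integral>p. h y (snd p) \<partial>\<pi>)"
    by (subst couplingsD(3)[OF \<pi>, symmetric], rule integral_distr[OF meas(2,3)])
  ultimately have "\<bar>(\<integral>z. h x z \<partial>\<mu>) - (\<integral>z. h y z \<partial>\<nu>)\<bar> = \<bar>\<integral>p. h x (fst p) - h y (snd p) \<partial>\<pi>\<bar>"
    using ints by simp
  also have "\<dots> \<le> (\<integral>p. \<bar>h x (fst p) - h y (snd p)\<bar> \<partial>\<pi>)"
    by (rule integral_abs_bound)
  also have "\<dots> \<le> (\<integral>p. K * (dist x y + dist (fst p) (snd p)) \<partial>\<pi>)"
    using ints h by (intro integral_mono) auto
  also have "\<dots> = K * (dist x y + (\<integral>p. dist (fst p) (snd p) \<partial>\<pi>))"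
    using ints(3) by (simp add: prob_space)
  finally show ?thesis .
qed

text \<open>The shifts differ through the starting points and through the measures; \<open>F\<close>
  multiplies the total by at most \<open>L\<close>. The contribution of the measures does not depend
  on \<open>x\<close> and \<open>y\<close>, so the bound can be integrated over
  \<open>\<pi>\<close>.\<close>

lemma dist_mf_map_le:
  assumes \<pi>: "\<pi> \<in> couplings \<mu> \<nu>"
  shows "dist (mf_map F h \<Delta> \<mu> x) (mf_map F h \<Delta> \<nu> y)
    \<le> L * (dist x y + \<Delta> * (K * (dist x y + (\<integral>p. dist (fst p) (snd p) \<partial>\<pi>))))"
proof -
  have "\<Delta> * \<bar>(\<integral>z. h x z \<partial>\<mu>) - (\<integral>z. h y z \<partial>\<nu>)\<bar>
      \<le> \<Delta> * (K * (dist x y + (\<integral>p. dist (fst p) (snd p) \<partial>\<pi>)))"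
    by (rule mult_left_mono[OF mean_field_integral_diff[OF \<pi>] \<Delta>])
  moreover have "dist (mf_shift h \<Delta> \<mu> x) (mf_shift h \<Delta> \<nu> y)
      \<le> dist x y + \<Delta> * \<bar>(\<integral>z. h x z \<partial>\<mu>) - (\<integral>z. h y z \<partial>\<nu>)\<bar>"
    using dist_shift_le[of x "\<Delta> * (\<integral>z. h x z \<partial>\<mu>)" y "\<Delta> * (\<integral>z. h y z \<partial>\<nu>)"] \<Delta>
    by (simp add: mf_shift_def abs_mult flip: right_diff_distrib)
  ultimately have "L * dist (mf_shift h \<Delta> \<mu> x) (mf_shift h \<Delta> \<nu> y)
      \<le> L * (dist x y + \<Delta> * (K * (dist x y + (\<integral>p. dist (fst p) (snd p) \<partial>\<pi>))))"
    using lipschitz_on_nonneg[OF F] by (intro mult_left_mono) auto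
  then show ?thesis
    using lipschitz_onD[OF F, of "mf_shift h \<Delta> \<mu> x" "mf_shift h \<Delta> \<nu> y"]
    by (simp add: mf_map_def)
qed

text \<open>Supplies the continuity that \<open>push_coupling\<close> asks for. With a single
  measure the integrands are compared at the same \<open>z\<close>, so no transport term
  appears.\<close>

lemma continuous_mf_map:
  assumes "\<mu> \<in> prob_measures"
  shows "continuous_on UNIV (mf_map F h \<Delta> \<mu>)"
proof -
  interpret prob_space \<mu> using assms by (rule prob_measures_prob_space)
  have diff: "\<bar>(\<integral>z. h x z \<partial>\<mu>) - (\<integral>z. h y z \<partial>\<mu>)\<bar> \<le> K * dist x y" for x y
  proof -
    have ints: "integrable \<mu> (h x)" for x
      by (rule integrable_continuous_compact[OF compact_UNIV_torus assms continuous_h])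
    have "\<bar>(\<integral>z. h x z \<partial>\<mu>) - (\<integral>z. h y z \<partial>\<mu>)\<bar> = \<bar>\<integral>z. h x z - h y z \<partial>\<mu>\<bar>"
      using ints by simp
    also have "\<dots> \<le> (\<integral>z. \<bar>h x z - h y z\<bar> \<partial>\<mu>)"
      by (rule integral_abs_bound)
    also have "\<dots> \<le> (\<integral>z. K * dist x y \<partial>\<mu>)"
      using ints h[of x _ y] by (intro integral_mono) (auto, metis add.right_neutral dist_self)
    finally show ?thesis by (simp add: prob_space)
  qed
  have "dist (mf_shift h \<Delta> \<mu> x) (mf_shift h \<Delta> \<mu> y) \<le> (1 + \<Delta> * K) * dist x y" for x y
  proof -
    have "dist (mf_shift h \<Delta> \<mu> x) (mf_shift h \<Delta> \<mu> y)
        \<le> dist x y + \<Delta> * \<bar>(\<integral>z. h x z \<partial>\<mu>) - (\<integral>z. h y z \<partial>\<mu>)\<bar>"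
      using dist_shift_le[of x "\<Delta> * (\<integral>z. h x z \<partial>\<mu>)" y "\<Delta> * (\<integral>z. h y z \<partial>\<mu>)"] \<Delta>
      by (simp add: mf_shift_def abs_mult flip: right_diff_distrib)
    also have "\<dots> \<le> dist x y + \<Delta> * (K * dist x y)"
      using diff \<Delta> by (intro add_left_mono mult_left_mono)
    finally show ?thesis by (simp add: distrib_right mult.assoc)
  qed
  then have "(1 + \<Delta> * K)-lipschitz_on UNIV (mf_shift h \<Delta> \<mu>)"
    using \<Delta> K by (intro lipschitz_onI) auto
  then show ?thesis
    unfolding mf_map_def
    by (intro continuous_on_compose lipschitz_on_continuous_on)
       (auto intro: lipschitz_on_subset[OF F])
qed

text \<open>The bound is proved for each coupling and the infimum is taken last. Nonemptiness is
  assumed here and supplied later for an empirical first marginal.\<close>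

lemma W1_mf_map_le:
  assumes \<mu>: "\<mu> \<in> prob_measures" and \<nu>: "\<nu> \<in> prob_measures" and ne: "couplings \<mu> \<nu> \<noteq> {}"
  shows "W1 (distr \<mu> borel (mf_map F h \<Delta> \<mu>)) (distr \<nu> borel (mf_map F h \<Delta> \<nu>))
    \<le> L * (1 + 2 * \<Delta> * K) * W1 \<mu> \<nu>"
proof (rule mult_W1_greatest[OF ne])
  let ?G = "mf_map F h \<Delta> \<mu>" and ?H = "mf_map F h \<Delta> \<nu>"
  show "0 \<le> L * (1 + 2 * \<Delta> * K)"
    using lipschitz_on_nonneg[OF F] \<Delta> K by simp
  fix \<pi> assume \<pi>: "\<pi> \<in> couplings \<mu> \<nu>"
  let ?c = "\<integral>p. dist (fst p) (snd p) \<partial>\<pi>"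
  interpret prob_space \<pi> using couplingsD(1)[OF \<pi>] by (rule prob_measures_prob_space)
  note int = integrable_continuous_compact[OF compact_UNIV_torus2 couplingsD(1)[OF \<pi>]]
  note cont = continuous_mf_map[OF \<mu>] continuous_mf_map[OF \<nu>]
  note cont2 = continuous_on_compose2[OF cont(1)] continuous_on_compose2[OF cont(2)]
  have GH: "continuous_on UNIV (map_prod ?G ?H)"
    unfolding map_prod_def case_prod_unfold by (intro continuous_intros cont2) auto
  have dist_cost: "integrable \<pi> (\<lambda>p. dist (fst p) (snd p))"
    by (intro int continuous_intros)
  have "W1 (distr \<mu> borel ?G) (distr \<nu> borel ?H)
      \<le> (\<integral>p. dist (fst p) (snd p) \<partial>(distr \<pi> borel (map_prod ?G ?H)))"
    by (rule W1_le[OF push_coupling[OF \<pi> cont]])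
  also have "\<dots> = (\<integral>p. dist (?G (fst p)) (?H (snd p)) \<partial>\<pi>)"
    using GH couplingsD(1)[OF \<pi>]
    by (subst integral_distr)
       (auto simp: measurable_prob_measures intro!: borel_measurable_continuous_onI continuous_intros)
  also have "\<dots> \<le> (\<integral>p. L * (dist (fst p) (snd p) + \<Delta> * (K * (dist (fst p) (snd p) + ?c))) \<partial>\<pi>)"
  proof (rule integral_mono)
    show "integrable \<pi> (\<lambda>p. dist (?G (fst p)) (?H (snd p)))"
      by (intro int continuous_intros cont2) auto
    show "integrable \<pi> (\<lambda>p. L * (dist (fst p) (snd p) + \<Delta> * (K * (dist (fst p) (snd p) + ?c))))"
      by (intro int continuous_intros)
  qed (rule dist_mf_map_le[OF \<pi>])
  \<comment> \<open>Origin of the factor 2: the local distance integrates to \<open>?c\<close>, and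
    the constant \<open>?c\<close> stays itself because \<open>\<pi>\<close> has mass 1.\<close>
  also have "\<dots> = L * (1 + 2 * \<Delta> * K) * ?c"
    using dist_cost by (simp add: prob_space algebra_simps)
  finally show "W1 (distr \<mu> borel ?G) (distr \<nu> borel ?H) \<le> L * (1 + 2 * \<Delta> * K) * ?c" .
qed

end

section \<open>Empirical measures as mean-field solutions\<close>

text \<open>Picking an index uniformly and taking its particle turns finite averages into
  push-forwards; coinciding particles keep their multiplicity.\<close>

lemma empirical_eq_distr:
  assumes "N \<ge> 1"
  shows "empirical N x = distr (uniform_count_measure {1..N}) borel x"
proof (rule measure_eqI)
  have "sigma_sets UNIV (sets (borel :: 'a measure)) = sets borel"
    using sets.sigma_sets_eq[of "borel :: 'a measure"] by simp
  then have "sets (empirical N x) = sets borel"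
    unfolding empirical_def by (subst sets_measure_of) auto
  then show sets: "sets (empirical N x) = sets (distr (uniform_count_measure {1..N}) borel x)"
    by simp
  fix A assume "A \<in> sets (empirical N x)"
  then have A: "A \<in> sets borel" using sets by simp
  have card: "(\<Sum>j=1..N. indicator A (x j)) = (of_nat (card (x -` A \<inter> {1..N})) :: ennreal)"
    unfolding indicator_def by (simp add: sum.If_cases Int_commute vimage_def)
  show "emeasure (empirical N x) A = emeasure (distr (uniform_count_measure {1..N}) borel x) A"
    using A assms card
    by (simp add: emeasure_empirical emeasure_distr emeasure_uniform_count_measure
        space_uniform_count_measure ennreal_of_nat_eq_real_of_nat divide_ennreal)
qed

lemma empirical_prob_measures:
  assumes "N \<ge> 1"
  shows "empirical N x \<in> prob_measures"
proof -
  interpret prob_space "uniform_count_measure {1..N}"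
    using assms by (intro prob_space_uniform_count_measure) auto
  show ?thesis
    unfolding empirical_eq_distr[OF assms] prob_measures_def
    by (simp add: prob_space_distr del: One_nat_def)
qed

lemma integral_empirical:
  fixes f :: "'a::topological_space \<Rightarrow> real"
  assumes "N \<ge> 1" "f \<in> borel_measurable borel"
  shows "(\<integral>y. f y \<partial>(empirical N x)) = (\<Sum>j=1..N. f (x j)) / real N"
  unfolding empirical_eq_distr[OF assms(1)] using assms(2)
  by (subst integral_distr) (auto simp: integral_uniform_count_measure)

lemma distr_empirical:
  assumes "N \<ge> 1" "G \<in> borel_measurable borel"
  shows "distr (empirical N x) borel G = empirical N (G \<circ> x)"
  unfolding empirical_eq_distr[OF assms(1)] using assms(2)
  by (subst distr_distr) auto

lemma empirical_cong:
  assumes "N \<ge> 1" "\<And>i. i \<in> {1..N} \<Longrightarrow> x i = y i"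
  shows "empirical N x = empirical N y"
  unfolding empirical_eq_distr[OF assms(1)] using assms(2)
  by (intro distr_cong) (auto simp: space_uniform_count_measure)

text \<open>
  With one marginal discrete, the product coupling is Borel without identifying the Borel sets of
  the product with the product \<open>\<sigma>\<close>-algebra.
\<close>

lemma couplings_empirical_nonempty:
  assumes N: "N \<ge> 1" and \<nu>: "\<nu> \<in> prob_measures"
  shows "couplings (empirical N x) \<nu> \<noteq> {}"
proof -
  define U where "U = uniform_count_measure {1..N}"
  interpret U: prob_space U
    unfolding U_def using N by (intro prob_space_uniform_count_measure) auto
  interpret \<nu>: prob_space \<nu> using \<nu> by (rule prob_measures_prob_space)
  interpret UV: pair_prob_space U \<nu> ..
  have sets_U: "sets U = sets (count_space {1..N})"
    by (simp add: U_def sets_uniform_count_measure)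
  have xU: "x \<in> U \<rightarrow>\<^sub>M borel"
    by (simp add: measurable_cong_sets[OF sets_U refl])
  \<comment> \<open>The law of \<open>g\<close> is the product coupling: an index drawn uniformly is
    replaced by its particle, next to an independent point drawn from \<open>\<nu>\<close>.\<close>
  define g where "g = (\<lambda>p. (x (fst p), snd p :: 'a))"
  \<comment> \<open>Since the first factor is countable, it suffices to check each section in
    \<open>y\<close>, which is continuous into the product space.\<close>
  have "g \<in> count_space {1..N} \<Otimes>\<^sub>M \<nu> \<rightarrow>\<^sub>M borel"
  proof (rule measurable_pair_measure_countable1)
    fix i
    have "(\<lambda>y. g (i, y)) \<in> borel_measurable borel"
      unfolding g_def by (intro borel_measurable_continuous_onI continuous_intros) auto
    then show "(\<lambda>y. g (i, y)) \<in> \<nu> \<rightarrow>\<^sub>M borel"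
      using \<nu> by (simp add: measurable_prob_measures)
  qed simp
  then have g: "g \<in> U \<Otimes>\<^sub>M \<nu> \<rightarrow>\<^sub>M borel"
    using measurable_cong_sets[OF sets_pair_measure_cong[OF sets_U refl] refl] by blast
  have fst_snd: "(fst :: 'a \<times> 'a \<Rightarrow> 'a) \<in> borel_measurable borel"
    "(snd :: 'a \<times> 'a \<Rightarrow> 'a) \<in> borel_measurable borel"
    by (intro borel_measurable_continuous_onI continuous_intros)+
  have "distr (distr (U \<Otimes>\<^sub>M \<nu>) borel g) borel fst = distr (distr (U \<Otimes>\<^sub>M \<nu>) U fst) borel x"
    using g xU fst_snd by (simp add: distr_distr) (simp add: g_def comp_def)
  also have "\<dots> = empirical N x"
    using \<nu>.distr_pair_fst[of U] by (simp add: empirical_eq_distr[OF N] U_def)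
  finally have fst: "distr (distr (U \<Otimes>\<^sub>M \<nu>) borel g) borel fst = empirical N x" .
  have "distr (distr (U \<Otimes>\<^sub>M \<nu>) borel g) borel snd = distr (U \<Otimes>\<^sub>M \<nu>) \<nu> snd"
    using g fst_snd prob_measures_sets[OF \<nu>]
    by (simp add: distr_distr) (intro distr_cong, simp_all add: g_def)
  also have "\<dots> = \<nu>"
  proof (rule measure_eqI)
    fix A assume "A \<in> sets (distr (U \<Otimes>\<^sub>M \<nu>) \<nu> snd)"
    then have A: "A \<in> sets \<nu>" by simp
    then have "snd -` A \<inter> space (U \<Otimes>\<^sub>M \<nu>) = space U \<times> A"
      by (auto simp: space_pair_measure dest: sets.sets_into_space)
    with A show "emeasure (distr (U \<Otimes>\<^sub>M \<nu>) \<nu> snd) A = emeasure \<nu> A"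
      by (simp add: emeasure_distr \<nu>.emeasure_pair_measure_Times U.emeasure_space_1)
  qed simp
  finally have "distr (U \<Otimes>\<^sub>M \<nu>) borel g \<in> couplings (empirical N x) \<nu>"
    using fst UV.prob_space_distr[OF g] by (simp add: couplings_def prob_measures_def)
  then show ?thesis by blast
qed

text \<open>The average over all \<open>j\<close>, including \<open>j = i\<close>, is the integral
  of \<open>h\<close> against the empirical measure. Hence every particle moves by the mean-field
  map of the current empirical measure.\<close>

lemma particle_solution_empirical:
  assumes N: "N \<ge> 1" and x: "particle_solution F h \<Delta> N x"
    and h: "\<And>x. h x \<in> borel_measurable borel"
    and G: "mf_map F h \<Delta> (empirical N (x t)) \<in> borel_measurable borel"
  shows "empirical N (x (t + 1)) =
    distr (empirical N (x t)) borel (mf_map F h \<Delta> (empirical N (x t)))"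
  unfolding distr_empirical[OF N G]
proof (rule empirical_cong[OF N])
  fix i assume "i \<in> {1..N}"
  then have "x (t + 1) i = F (x t i \<oplus> \<Delta> / real N * (\<Sum>j=1..N. h (x t i) (x t j)))"
    using x unfolding particle_solution_def by blast
  then show "x (t + 1) i = (mf_map F h \<Delta> (empirical N (x t)) \<circ> x t) i"
    by (simp add: mf_map_def mf_shift_def integral_empirical[OF N h])
qed

text \<open>Choosing \<open>C\<close> before \<open>F\<close>, \<open>h\<close> and
  \<open>\<Delta>\<close>, as a function of three reals, expresses that the constant depends on
  nothing else.\<close>

theorem theorem1p1:
  shows "\<exists>C :: real \<Rightarrow> real \<Rightarrow> real \<Rightarrow> real.
    \<forall>(F :: torus \<Rightarrow> torus) (h :: torus \<Rightarrow> torus \<Rightarrow> real) (\<Delta> :: real).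
      (\<exists>L. L-lipschitz_on UNIV F) \<and> C1_torus2 h \<and> \<Delta> > 0 \<longrightarrow>
        C \<Delta> (Lip F) (C1_norm h) > 0 \<and>
        (\<forall>(N :: nat) (x :: nat \<Rightarrow> nat \<Rightarrow> torus) (\<rho> :: nat \<Rightarrow> torus measure).
          N \<ge> 1 \<and> particle_solution F h \<Delta> N x \<and> mf_solution F h \<Delta> \<rho> \<longrightarrow>
            (\<forall>t :: nat. W1 (empirical N (x t)) (\<rho> t)
               \<le> exp (C \<Delta> (Lip F) (C1_norm h) * real t) * W1 (empirical N (x 0)) (\<rho> 0)))"
\<comment> \<open>One step expands by at most \<open>A = L * (1 + 2 * \<Delta> * K)\<close>, and
  \<open>A \<le> exp (1 + A)\<close>. The summand 1 keeps the constant positive even if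
  \<open>Lip F = 0\<close>.\<close>
proof (intro exI[of _ "\<lambda>\<Delta> L K. 1 + L * (1 + 2 * \<Delta> * K)"] allI impI conjI; elim conjE exE)
  fix F :: "torus \<Rightarrow> torus" and h and \<Delta> L :: real
  assume L: "L-lipschitz_on UNIV F" and h: "C1_torus2 h" and \<Delta>: "\<Delta> > 0"
  let ?A = "Lip F * (1 + 2 * \<Delta> * C1_norm h)"
  note F = lipschitz_on_Lip[OF L]
  note hlip = C1_torus2_lipschitz(1)[OF h]
  note hK = C1_torus2_lipschitz(2)[OF h]
  have A: "?A \<ge> 0"
    using lipschitz_on_nonneg[OF F] \<Delta> hK by simp
  then show "1 + ?A > 0" by simp
  fix N x \<rho> t
  assume N: "1 \<le> N" and x: "particle_solution F h \<Delta> N x" and \<rho>: "mf_solution F h \<Delta> \<rho>"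
  note hyps = F less_imp_le[OF \<Delta>] hK hlip
  have \<rho>P: "\<rho> t \<in> prob_measures" for t
    using \<rho> by (simp add: mf_solution_def)
  show "W1 (empirical N (x t)) (\<rho> t) \<le> exp ((1 + ?A) * real t) * W1 (empirical N (x 0)) (\<rho> 0)"
  proof (induction t)
    case (Suc t)
    have emp: "empirical N (x t) \<in> prob_measures"
      by (rule empirical_prob_measures[OF N])
    \<comment> \<open>Nonnegativity permits replacing the factor \<open>?A\<close> by the larger
      \<open>exp (1 + ?A)\<close> below.\<close>
    have W1_nonneg: "0 \<le> W1 (empirical N (x t)) (\<rho> t)"
      unfolding W1_def using couplings_empirical_nonempty[OF N \<rho>P]
      by (intro cINF_greatest integral_nonneg_AE) auto
    have "empirical N (x (Suc t)) =
        distr (empirical N (x t)) borel (mf_map F h \<Delta> (empirical N (x t)))"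
      using particle_solution_empirical[OF N x, of t] continuous_mf_map[OF hyps emp]
        continuous_h[OF hyps] by (simp add: borel_measurable_continuous_onI)
    moreover have "\<rho> (Suc t) = distr (\<rho> t) borel (mf_map F h \<Delta> (\<rho> t))"
      using \<rho> by (simp add: mf_solution_def)
    ultimately have "W1 (empirical N (x (Suc t))) (\<rho> (Suc t)) \<le> ?A * W1 (empirical N (x t)) (\<rho> t)"
      using W1_mf_map_le[OF hyps emp \<rho>P couplings_empirical_nonempty[OF N \<rho>P]] by simp
    also have "\<dots> \<le> exp (1 + ?A) * W1 (empirical N (x t)) (\<rho> t)"
      using exp_ge_add_one_self[of "1 + ?A"] A W1_nonneg by (intro mult_right_mono) linarith+
    also have "\<dots> \<le> exp (1 + ?A) * (exp ((1 + ?A) * real t) * W1 (empirical N (x 0)) (\<rho> 0))"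
      by (intro mult_left_mono Suc.IH) simp
    also have "\<dots> = exp ((1 + ?A) * real (Suc t)) * W1 (empirical N (x 0)) (\<rho> 0)"
      by (simp add: distrib_left exp_add)
    finally show ?case .
  qed simp
qed

end
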